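(* Let $\varepsilon>0$, let $\mu\in\mathcal P_4(\mathbb R^{d_x})$, $\nu\in\mathcal P_4(\mathbb R^{d_y})$, and let $M_{\mu,\nu}:=\sqrt{M_2(\mu)M_2(\nu)}$. Then $$\mathsf S^2_{\varepsilon}(\mu,\nu)=\inf_{\mathbf A\in\mathbb R^{d_x\times d_y}}\Big\{32\|\mathbf A\|_{\mathrm F}^2+\mathsf{OT}_{\mathbf A,\varepsilon}(\mu,\nu)\Big\}.$$ Moreover, the infimum is achieved at some $\mathbf A^\star\in\mathcal D_{M_{\mu,\nu}}:=[-M_{\mu,\nu}/2,\,M_{\mu,\nu}/2]^{d_x\times d_y}$.
   Context: $\mathcal P_p(\mathbb R^d)$ is the set of Borel probability measures $\rho$ on $\mathbb R^d$ with $M_p(\rho):=\int\|x\|^p\,d\rho(x)<\infty$. $\Pi(\mu,\nu)$ is the set of couplings of $\mu$ and $\nu$. $\mathsf D_{\mathsf{KL}}(\alpha\|\beta)=\int\log(d\alpha/d\beta)\,d\alpha$ if $\alpha\ll\beta$ and $+\infty$ otherwise. $\|\cdot\|_{\mathrm F}$ is the Frobenius norm. The functional $\mathsf S^2_\varepsilon$ (the coupling-dependent part of the entropic Gromov-Wasserstein functional) is $$\mathsf S^2_{\varepsilon}(\mu,\nu):=\inf_{\pi\in\Pi(\mu,\nu)}\int -4\|x\|^2\|y\|^2\,d\pi(x,y)-8\sum_{\substack{1\le i\le d_x\\1\le j\le d_y}}\Big(\int x_iy_j\,d\pi(x,y)\Big)^2+\varepsilon\,\mathsf D_{\mathsf{KL}}(\pi\|\mu\otimes\nu).$$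 For $\mathbf A\in\mathbb R^{d_x\times d_y}$, define the cost $c_{\mathbf A}(x,y):=-4\|x\|^2\|y\|^2-32\,x^{\intercal}\mathbf A y$ for $(x,y)\in\mathbb R^{d_x}\times\mathbb R^{d_y}$, and the entropic optimal transport problem $$\mathsf{OT}_{\mathbf A,\varepsilon}(\mu,\nu):=\inf_{\pi\in\Pi(\mu,\nu)}\int c_{\mathbf A}\,d\pi+\varepsilon\,\mathsf D_{\mathsf{KL}}(\pi\|\mu\otimes\nu).$$ *)

theory Defs
  imports "HOL-Probability.Probability"
begin

definition prob_moment_space :: "nat \<Rightarrow> 'a::euclidean_space measure set" where
  "prob_moment_space p =
     {\<rho>. prob_space \<rho> \<and> sets \<rho> = sets borel \<and> integrable \<rho> (\<lambda>x. norm x ^ p)}"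

definition moment :: "nat \<Rightarrow> 'a::euclidean_space measure \<Rightarrow> real" where
  "moment p \<rho> = (\<integral>x. norm x ^ p \<partial>\<rho>)"

definition couplings :: "'a measure \<Rightarrow> 'b measure \<Rightarrow> ('a \<times> 'b) measure set" where
  "couplings \<mu> \<nu> =
     {\<pi>. sets \<pi> = sets (\<mu> \<Otimes>\<^sub>M \<nu>) \<and> distr \<pi> \<mu> fst = \<mu> \<and> distr \<pi> \<nu> snd = \<nu>}"

text \<open>The library's \<^const>\<open>KL_divergence\<close> takes the reference measure first, and as a
  real-valued Bochner integral it is 0 when the log-density is not integrable. For probability
  measures the negative part of the log-density \<open>ln (d\<alpha>/d\<beta>)\<close> is always \<open>\<alpha>\<close>-integrable,
  so non-integrability means exactly that the integral is \<open>+\<infinity>\<close>.\<close>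

definition KL :: "'a measure \<Rightarrow> 'a measure \<Rightarrow> ereal" where
  "KL \<alpha> \<beta> =
     (if absolutely_continuous \<beta> \<alpha> \<and> integrable \<alpha> (entropy_density (exp 1) \<beta> \<alpha>)
      then ereal (KL_divergence (exp 1) \<beta> \<alpha>) else \<infinity>)"

definition frobenius_norm :: "real^'m^'n \<Rightarrow> real" where
  "frobenius_norm A = sqrt (\<Sum>i\<in>UNIV. \<Sum>j\<in>UNIV. (A $ i $ j)\<^sup>2)"

definition S2 :: "real \<Rightarrow> (real^'n) measure \<Rightarrow> (real^'m) measure \<Rightarrow> ereal" where
  "S2 \<epsilon> \<mu> \<nu> =
     (INF \<pi>\<in>couplings \<mu> \<nu>.
        ereal ((\<integral>(x, y). - 4 * (norm x)\<^sup>2 * (norm y)\<^sup>2 \<partial>\<pi>)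
               - 8 * (\<Sum>i\<in>UNIV. \<Sum>j\<in>UNIV. (\<integral>(x, y). x $ i * y $ j \<partial>\<pi>)\<^sup>2))
        + ereal \<epsilon> * KL \<pi> (\<mu> \<Otimes>\<^sub>M \<nu>))"

definition cost :: "real^'m^'n \<Rightarrow> real^'n \<Rightarrow> real^'m \<Rightarrow> real" where
  "cost A x y = - 4 * (norm x)\<^sup>2 * (norm y)\<^sup>2 - 32 * (x \<bullet> (A *v y))"

definition OT :: "real^'m^'n \<Rightarrow> real \<Rightarrow> (real^'n) measure \<Rightarrow> (real^'m) measure \<Rightarrow> ereal" where
  "OT A \<epsilon> \<mu> \<nu> =
     (INF \<pi>\<in>couplings \<mu> \<nu>.
        ereal (\<integral>(x, y). cost A x y \<partial>\<pi>) + ereal \<epsilon> * KL \<pi> (\<mu> \<Otimes>\<^sub>M \<nu>))"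

definition matrix_box :: "real \<Rightarrow> (real^'m^'n) set" where
  "matrix_box M = {A. \<forall>i j. A $ i $ j \<in> {- M / 2 .. M / 2}}"

end

theory Submission
  imports Defs
begin

text \<open>
  Fix a coupling \<open>\<pi>\<close>, let \<open>m\<^sub>\<pi>\<close> be its matrix of cross moments
  \<open>\<integral> x\<^sub>i y\<^sub>j d\<pi>\<close>, and let \<open>v \<pi>\<close> be the value at \<open>\<pi>\<close> of the functional minimised
  in \<open>S2\<close>. Since \<open>\<integral> x \<bullet> A y d\<pi> = A \<bullet> m\<^sub>\<pi>\<close>, completing the square gives
  \<open>32 \<parallel>A\<parallel>\<^sup>2 + \<integral> c\<^sub>A d\<pi> + \<epsilon> KL = v \<pi> + 32 \<parallel>A - m\<^sub>\<pi> / 2\<parallel>\<^sup>2\<close>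
  (lemma \<open>cost_complete_square\<close>). The right-hand side is at least \<open>v \<pi>\<close>, with equality
  at \<open>A = m\<^sub>\<pi> / 2\<close>, so exchanging the two infima yields the formula. By the Cauchy-Schwarz
  inequality \<open>m\<^sub>\<pi> / 2\<close> always lies in the compact box (lemma \<open>half_cross_moment_in_box\<close>).

  For the existence of a minimiser no compactness of the set of couplings is needed: along a
  minimising sequence of couplings \<open>\<pi>\<^sub>n\<close> a subsequence of the matrices \<open>m\<^sub>\<pi>\<^sub>n / 2\<close>
  converges to some \<open>A\<close> in the box, and then
  \<open>v \<pi>\<^sub>n + 32 \<parallel>A - m\<^sub>\<pi>\<^sub>n / 2\<parallel>\<^sup>2\<close> tends to \<open>inf v\<close> along it, so
  \<open>A\<close> attains the infimum (lemma \<open>INF_penalty_attained\<close>).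
\<close>

section \<open>Infima with a quadratic penalty\<close>

lemma INF_ereal_const_add:
  fixes f :: "'i \<Rightarrow> ereal"
  shows "(INF i\<in>I. ereal c + f i) = ereal c + (INF i\<in>I. f i)"
proof (rule antisym)
  have "(INF i\<in>I. ereal c + f i) - ereal c \<le> (INF i\<in>I. f i)"
  proof (rule INF_greatest)
    fix j assume "j \<in> I"
    then have "(INF i\<in>I. ereal c + f i) \<le> ereal c + f j" by (rule INF_lower)
    then show "(INF i\<in>I. ereal c + f i) - ereal c \<le> f j"
      by (simp add: ereal_minus_le_iff add.commute)
  qed
  then show "(INF i\<in>I. ereal c + f i) \<le> ereal c + (INF i\<in>I. f i)"
    by (simp add: ereal_minus_le_iff add.commute)
  show "ereal c + (INF i\<in>I. f i) \<le> (INF i\<in>I. ereal c + f i)"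
    by (intro INF_greatest add_left_mono INF_lower)
qed

text \<open>The penalised infimum over \<open>I\<close>, as a function of \<open>A\<close>, is bounded below by the unpenalised
  one, and the bound is attained on every nonempty compact set that contains all centres
  \<open>p i\<close>: an accumulation point of the centres along a minimising sequence of indices pays no
  penalty in the limit. The infima may be infinite.\<close>

lemma INF_penalty_attained:
  fixes p :: "'i \<Rightarrow> 'e::metric_space" and v :: "'i \<Rightarrow> ereal" and c :: real
  assumes "0 \<le> c" "compact K" "K \<noteq> {}" and pK: "\<And>i. i \<in> I \<Longrightarrow> p i \<in> K"
  defines "F \<equiv> (\<lambda>A. INF i\<in>I. v i + ereal (c * (dist A (p i))\<^sup>2))"
  shows "(INF i\<in>I. v i) = (INF A. F A)" and "\<exists>A\<in>K. F A = (INF B. F B)"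
proof -
  let ?V = "INF i\<in>I. v i"
  have ge: "?V \<le> F A" for A
    unfolding F_def
  proof (rule INF_mono')
    fix i show "v i \<le> v i + ereal (c * (dist A (p i))\<^sup>2)"
      using assms(1) by (intro ereal_le_add_self) auto
  qed
  have "\<exists>A\<in>K. F A \<le> ?V"
  proof (cases "I = {}")
    case True
    \<comment> \<open>Both sides are then \<open>\<infinity>\<close>.\<close>
    then show ?thesis using assms(3) by auto
  next
    case False
    then obtain u where u: "\<And>n. u n \<in> v ` I" and lim: "u \<longlonglongrightarrow> ?V"
      using Inf_as_limit[of "v ` I"] by auto
    have "\<forall>n. \<exists>i. i \<in> I \<and> u n = v i" using u by blast
    then obtain s where s: "\<And>n. s n \<in> I" "\<And>n. u n = v (s n)"
      using choice[of "\<lambda>n i. i \<in> I \<and> u n = v i"] by blast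
    obtain A r where A: "A \<in> K" and r: "strict_mono (r :: nat \<Rightarrow> nat)"
        and pA: "(\<lambda>n. p (s (r n))) \<longlonglongrightarrow> A"
      using seq_compactE[of K "\<lambda>n. p (s n)"] assms(2) pK[OF s(1)]
      by (auto simp: compact_eq_seq_compact_metric comp_def)
    have pen: "(\<lambda>n. ereal (c * (dist A (p (s (r n))))\<^sup>2)) \<longlonglongrightarrow> 0"
    proof -
      have "(\<lambda>n. c * (dist A (p (s (r n))))\<^sup>2) \<longlonglongrightarrow> c * (dist A A)\<^sup>2"
        by (intro tendsto_intros pA)
      then show ?thesis by (simp add: zero_ereal_def)
    qed
    have "(\<lambda>n. v (s (r n))) \<longlonglongrightarrow> ?V"
      using LIMSEQ_subseq_LIMSEQ[OF lim r] by (simp add: comp_def s(2))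
    from tendsto_add_ereal_general[OF _ this pen]
    have "(\<lambda>n. v (s (r n)) + ereal (c * (dist A (p (s (r n))))\<^sup>2)) \<longlonglongrightarrow> ?V"
      by simp
    then have "F A \<le> ?V"
      unfolding F_def by (rule Lim_bounded2) (auto intro!: INF_lower s)
    with A show ?thesis by blast
  qed
  then obtain A where "A \<in> K" "F A = ?V" using ge by (metis antisym)
  moreover have "?V = (INF A. F A)"
  proof (rule antisym)
    show "?V \<le> (INF A. F A)" by (intro INF_greatest ge)
    show "(INF A. F A) \<le> ?V" using INF_lower[of A UNIV F] \<open>F A = ?V\<close> by simp
  qed
  ultimately show "?V = (INF A. F A)" "\<exists>A\<in>K. F A = (INF B. F B)" by auto
qed

section \<open>Moments under couplings\<close>

lemma Cauchy_Schwarz_integral: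
  fixes f g :: "'a \<Rightarrow> real"
  assumes f: "f \<in> borel_measurable M" "integrable M (\<lambda>x. (f x)\<^sup>2)"
    and g: "g \<in> borel_measurable M" "integrable M (\<lambda>x. (g x)\<^sup>2)"
  shows "integrable M (\<lambda>x. f x * g x)"
    and "\<bar>\<integral>x. f x * g x \<partial>M\<bar> \<le> sqrt ((\<integral>x. (f x)\<^sup>2 \<partial>M) * (\<integral>x. (g x)\<^sup>2 \<partial>M))"
proof -
  show int: "integrable M (\<lambda>x. f x * g x)"
  proof (rule Bochner_Integration.integrable_bound)
    show "integrable M (\<lambda>x. (f x)\<^sup>2 + (g x)\<^sup>2)" using f g by simp
    show "AE x in M. norm (f x * g x) \<le> norm ((f x)\<^sup>2 + (g x)\<^sup>2)"
    proof (rule AE_I2)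
      fix x
      have "2 * (\<bar>f x\<bar> * \<bar>g x\<bar>) \<le> (f x)\<^sup>2 + (g x)\<^sup>2"
        using sum_squares_bound[of "\<bar>f x\<bar>" "\<bar>g x\<bar>"] by (simp add: mult.assoc)
      moreover have "0 \<le> \<bar>f x\<bar> * \<bar>g x\<bar>" by simp
      ultimately have "\<bar>f x\<bar> * \<bar>g x\<bar> \<le> (f x)\<^sup>2 + (g x)\<^sup>2" by linarith
      then show "norm (f x * g x) \<le> norm ((f x)\<^sup>2 + (g x)\<^sup>2)"
        by (simp add: abs_mult)
    qed
  qed (use f g in measurable)
  let ?N = "\<integral>x. \<bar>f x * g x\<bar> \<partial>M"
  have sq: "(ennreal \<bar>t\<bar>)\<^sup>2 = ennreal (t\<^sup>2)" for t :: real
    by (simp add: ennreal_power)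
  have "ennreal (?N\<^sup>2) = (\<integral>\<^sup>+x. ennreal \<bar>f x\<bar> * ennreal \<bar>g x\<bar> \<partial>M)\<^sup>2"
    using nn_integral_eq_integral[OF integrable_abs[OF int]]
    by (simp add: ennreal_power abs_mult flip: ennreal_mult')
  also have "\<dots> \<le> (\<integral>\<^sup>+x. (ennreal \<bar>f x\<bar>)\<^sup>2 \<partial>M) * (\<integral>\<^sup>+x. (ennreal \<bar>g x\<bar>)\<^sup>2 \<partial>M)"
    by (rule Cauchy_Schwarz_nn_integral) (use f g in measurable)
  also have "\<dots> = ennreal ((\<integral>x. (f x)\<^sup>2 \<partial>M) * (\<integral>x. (g x)\<^sup>2 \<partial>M))"
    using f g by (simp add: sq nn_integral_eq_integral ennreal_mult)
  finally have "?N\<^sup>2 \<le> (\<integral>x. (f x)\<^sup>2 \<partial>M) * (\<integral>x. (g x)\<^sup>2 \<partial>M)"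
    by (simp add: ennreal_le_iff)
  then have "?N \<le> sqrt ((\<integral>x. (f x)\<^sup>2 \<partial>M) * (\<integral>x. (g x)\<^sup>2 \<partial>M))"
    by (rule real_le_rsqrt)
  moreover have "\<bar>\<integral>x. f x * g x \<partial>M\<bar> \<le> ?N" by (rule integral_abs_bound)
  ultimately show "\<bar>\<integral>x. f x * g x \<partial>M\<bar> \<le> sqrt ((\<integral>x. (f x)\<^sup>2 \<partial>M) * (\<integral>x. (g x)\<^sup>2 \<partial>M))"
    by linarith
qed

lemma prob_moment_space_4_2:
  assumes "\<rho> \<in> prob_moment_space 4"
  shows "\<rho> \<in> prob_moment_space 2"
proof -
  interpret prob_space \<rho> using assms by (simp add: prob_moment_space_def)
  have sets: "sets \<rho> = sets borel" and i4: "integrable \<rho> (\<lambda>x. norm x ^ 4)"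
    using assms by (auto simp: prob_moment_space_def)
  have m: "(\<lambda>x. norm x ^ 2) \<in> borel_measurable \<rho>"
    unfolding measurable_cong_sets[OF sets refl] by measurable
  have "integrable \<rho> (\<lambda>x. norm x ^ 2)"
  proof (rule Bochner_Integration.integrable_bound[OF _ m])
    show "integrable \<rho> (\<lambda>x. 1 + norm x ^ 4)" using i4 by simp
    have "t\<^sup>2 \<le> 1 + t ^ 4" for t :: real
    proof -
      have "2 * t\<^sup>2 \<le> 1 + t ^ 4" using sum_squares_bound[of "t\<^sup>2" 1] by simp
      moreover have "0 \<le> t\<^sup>2" by simp
      ultimately show ?thesis by linarith
    qed
    then show "AE x in \<rho>. norm (norm x ^ 2) \<le> norm (1 + norm x ^ 4)" by simp
  qed
  then show ?thesis using sets by (simp add: prob_moment_space_def prob_space_axioms)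
qed

lemma couplings_marginals:
  fixes f :: "'a \<Rightarrow> real" and g :: "'b \<Rightarrow> real"
  assumes "\<pi> \<in> couplings \<mu> \<nu>"
  shows "f \<in> borel_measurable \<mu> \<Longrightarrow> (\<lambda>z. f (fst z)) \<in> borel_measurable \<pi>"
    and "integrable \<mu> f \<Longrightarrow> integrable \<pi> (\<lambda>z. f (fst z))"
    and "f \<in> borel_measurable \<mu> \<Longrightarrow> (\<integral>z. f (fst z) \<partial>\<pi>) = (\<integral>x. f x \<partial>\<mu>)"
    and "g \<in> borel_measurable \<nu> \<Longrightarrow> (\<lambda>z. g (snd z)) \<in> borel_measurable \<pi>"
    and "integrable \<nu> g \<Longrightarrow> integrable \<pi> (\<lambda>z. g (snd z))"
    and "g \<in> borel_measurable \<nu> \<Longrightarrow> (\<integral>z. g (snd z) \<partial>\<pi>) = (\<integral>y. g y \<partial>\<nu>)"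
proof -
  have sets: "sets \<pi> = sets (\<mu> \<Otimes>\<^sub>M \<nu>)" and d: "distr \<pi> \<mu> fst = \<mu>" "distr \<pi> \<nu> snd = \<nu>"
    using assms by (auto simp: couplings_def)
  have m: "fst \<in> measurable \<pi> \<mu>" "snd \<in> measurable \<pi> \<nu>"
    by (simp_all add: measurable_cong_sets[OF sets refl])
  show "f \<in> borel_measurable \<mu> \<Longrightarrow> (\<lambda>z. f (fst z)) \<in> borel_measurable \<pi>"
    "g \<in> borel_measurable \<nu> \<Longrightarrow> (\<lambda>z. g (snd z)) \<in> borel_measurable \<pi>"
    using measurable_compose[OF m(1)] measurable_compose[OF m(2)] by blast+
  show "integrable \<mu> f \<Longrightarrow> integrable \<pi> (\<lambda>z. f (fst z))"
    "integrable \<nu> g \<Longrightarrow> integrable \<pi> (\<lambda>z. g (snd z))"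
    using integrable_distr[OF m(1), of f] integrable_distr[OF m(2), of g] by (simp_all add: d)
  show "f \<in> borel_measurable \<mu> \<Longrightarrow> (\<integral>z. f (fst z) \<partial>\<pi>) = (\<integral>x. f x \<partial>\<mu>)"
    "g \<in> borel_measurable \<nu> \<Longrightarrow> (\<integral>z. g (snd z) \<partial>\<pi>) = (\<integral>y. g y \<partial>\<nu>)"
    using integral_distr[OF m(1), of f] integral_distr[OF m(2), of g] by (simp_all add: d)
qed

lemma coupling_product_Cauchy_Schwarz:
  fixes f :: "'a \<Rightarrow> real" and g :: "'b \<Rightarrow> real"
  assumes \<pi>: "\<pi> \<in> couplings \<mu> \<nu>"
    and f: "f \<in> borel_measurable \<mu>" "integrable \<mu> (\<lambda>x. (f x)\<^sup>2)"
    and g: "g \<in> borel_measurable \<nu>" "integrable \<nu> (\<lambda>y. (g y)\<^sup>2)"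
  shows "integrable \<pi> (\<lambda>(x, y). f x * g y)"
    and "\<bar>\<integral>(x, y). f x * g y \<partial>\<pi>\<bar> \<le> sqrt ((\<integral>x. (f x)\<^sup>2 \<partial>\<mu>) * (\<integral>y. (g y)\<^sup>2 \<partial>\<nu>))"
proof -
  note c = couplings_marginals[OF \<pi>]
  note cs = Cauchy_Schwarz_integral[OF c(1)[OF f(1)] c(2)[OF f(2)] c(4)[OF g(1)] c(5)[OF g(2)]]
  show "integrable \<pi> (\<lambda>(x, y). f x * g y)" using cs(1) by (simp add: case_prod_unfold)
  show "\<bar>\<integral>(x, y). f x * g y \<partial>\<pi>\<bar> \<le> sqrt ((\<integral>x. (f x)\<^sup>2 \<partial>\<mu>) * (\<integral>y. (g y)\<^sup>2 \<partial>\<nu>))"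
    using cs(2) c(3)[of "\<lambda>x. (f x)\<^sup>2"] c(6)[of "\<lambda>y. (g y)\<^sup>2"] f g
    by (simp add: case_prod_unfold)
qed

text \<open>The matrix of cross moments \<open>\<integral> x\<^sub>i y\<^sub>j d\<pi>\<close> of a measure on the product space. An
  entry whose integrand is not integrable is 0; this does not occur for couplings of measures with
  finite second moments.\<close>

definition cross_moment :: "((real^'n) \<times> (real^'m)) measure \<Rightarrow> real^'m^'n" where
  "cross_moment \<pi> = (\<chi> i j. \<integral>(x, y). x $ i * y $ j \<partial>\<pi>)"

lemma component_square_integrable:
  fixes \<rho> :: "(real^'n) measure"
  assumes "\<rho> \<in> prob_moment_space 2"
  shows "(\<lambda>x. x $ i) \<in> borel_measurable \<rho>" and "integrable \<rho> (\<lambda>x. (x $ i)\<^sup>2)"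
    and "(\<integral>x. (x $ i)\<^sup>2 \<partial>\<rho>) \<le> moment 2 \<rho>"
proof -
  have sets: "sets \<rho> = sets borel" and i2: "integrable \<rho> (\<lambda>x. norm x ^ 2)"
    using assms by (auto simp: prob_moment_space_def)
  show m: "(\<lambda>x. x $ i) \<in> borel_measurable \<rho>"
    unfolding measurable_cong_sets[OF sets refl]
    by (intro borel_measurable_continuous_onI continuous_intros)
  have le: "(x $ i)\<^sup>2 \<le> (norm x)\<^sup>2" for x :: "real^'n"
    using component_le_norm_cart[of x i] by (intro abs_le_square_iff[THEN iffD1]) auto
  show int: "integrable \<rho> (\<lambda>x. (x $ i)\<^sup>2)"
    by (rule Bochner_Integration.integrable_bound[OF i2]) (use m le in auto)
  show "(\<integral>x. (x $ i)\<^sup>2 \<partial>\<rho>) \<le> moment 2 \<rho>"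
    unfolding moment_def by (rule integral_mono[OF int i2 le])
qed

lemma half_cross_moment_in_box:
  assumes \<pi>: "\<pi> \<in> couplings \<mu> \<nu>"
    and \<mu>: "\<mu> \<in> prob_moment_space 2" and \<nu>: "\<nu> \<in> prob_moment_space 2"
  shows "(1/2) *\<^sub>R cross_moment \<pi> \<in> matrix_box (sqrt (moment 2 \<mu> * moment 2 \<nu>))"
proof -
  have "\<bar>cross_moment \<pi> $ i $ j\<bar> \<le> sqrt (moment 2 \<mu> * moment 2 \<nu>)" for i j
  proof -
    note a = component_square_integrable[OF \<mu>, of i] and b = component_square_integrable[OF \<nu>, of j]
    have "\<bar>cross_moment \<pi> $ i $ j\<bar> \<le> sqrt ((\<integral>x. (x $ i)\<^sup>2 \<partial>\<mu>) * (\<integral>y. (y $ j)\<^sup>2 \<partial>\<nu>))"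
      using coupling_product_Cauchy_Schwarz(2)[OF \<pi> a(1,2) b(1,2)] by (simp add: cross_moment_def)
    also have "\<dots> \<le> sqrt (moment 2 \<mu> * moment 2 \<nu>)"
      using a(3) b(3) by (intro real_sqrt_le_mono mult_mono') auto
    finally show ?thesis .
  qed
  then have "- sqrt (moment 2 \<mu> * moment 2 \<nu>) \<le> cross_moment \<pi> $ i $ j"
      "cross_moment \<pi> $ i $ j \<le> sqrt (moment 2 \<mu> * moment 2 \<nu>)" for i j
    by (simp_all add: abs_le_iff minus_le_iff[of "sqrt _"])
  then show ?thesis
    by (simp add: matrix_box_def)
qed

section \<open>The space of matrices\<close>

lemma frobenius_norm_eq_norm: "frobenius_norm A = norm A"
  by (simp add: frobenius_norm_def norm_vec_def L2_set_def sum_nonneg)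

lemma compact_matrix_box: "compact (matrix_box M :: (real^'m^'n) set)"
proof (rule compact_eq_bounded_closed[THEN iffD2], intro conjI)
  let ?K = "matrix_box M :: (real^'m^'n) set"
  have "norm A \<le> (\<Sum>i\<in>(UNIV::'n set). \<Sum>j\<in>(UNIV::'m set). \<bar>M\<bar>)" if "A \<in> ?K" for A
  proof -
    have "norm A \<le> (\<Sum>i\<in>UNIV. norm (A $ i))"
      unfolding norm_vec_def by (rule L2_set_le_sum) simp
    also have "\<dots> \<le> (\<Sum>i\<in>UNIV. \<Sum>j\<in>UNIV. \<bar>A $ i $ j\<bar>)"
      by (intro sum_mono norm_le_l1_cart)
    also have "\<dots> \<le> (\<Sum>i\<in>(UNIV::'n set). \<Sum>j\<in>(UNIV::'m set). \<bar>M\<bar>)"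
    proof (intro sum_mono)
      fix i j
      have "- M / 2 \<le> A $ i $ j" "A $ i $ j \<le> M / 2" using that by (auto simp: matrix_box_def)
      then show "\<bar>A $ i $ j\<bar> \<le> \<bar>M\<bar>" by linarith
    qed
    finally show ?thesis .
  qed
  then show "bounded ?K" unfolding bounded_iff by blast
  show "closed ?K"
    unfolding matrix_box_def atLeastAtMost_iff
    by (intro closed_Collect_all closed_Collect_conj closed_Collect_le continuous_intros)
qed

section \<open>Completing the square\<close>

text \<open>The fourth moments make both parts of the cost \<open>\<pi>\<close>-integrable, so that the integral may
  be split.\<close>

lemma integral_cost:
  fixes \<mu> :: "(real^'n) measure" and \<nu> :: "(real^'m) measure"
  assumes \<pi>: "\<pi> \<in> couplings \<mu> \<nu>"
    and \<mu>: "\<mu> \<in> prob_moment_space 4" and \<nu>: "\<nu> \<in> prob_moment_space 4"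
  shows "(\<integral>(x, y). cost A x y \<partial>\<pi>) =
    (\<integral>(x, y). - 4 * (norm x)\<^sup>2 * (norm y)\<^sup>2 \<partial>\<pi>) - 32 * (A \<bullet> cross_moment \<pi>)"
proof -
  have sq: "(\<lambda>x. (norm x)\<^sup>2) \<in> borel_measurable \<rho>" "integrable \<rho> (\<lambda>x. ((norm x)\<^sup>2)\<^sup>2)"
    if "\<rho> \<in> prob_moment_space 4" for \<rho> :: "'c::euclidean_space measure"
  proof -
    have sets: "sets \<rho> = sets borel" and i4: "integrable \<rho> (\<lambda>x. norm x ^ 4)"
      using that by (auto simp: prob_moment_space_def)
    show "(\<lambda>x. (norm x)\<^sup>2) \<in> borel_measurable \<rho>"
      unfolding measurable_cong_sets[OF sets refl] by measurable
    show "integrable \<rho> (\<lambda>x. ((norm x)\<^sup>2)\<^sup>2)" using i4 by simp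
  qed
  have "integrable \<pi> (\<lambda>(x, y). (norm x)\<^sup>2 * (norm y)\<^sup>2)"
    by (rule coupling_product_Cauchy_Schwarz(1)[OF \<pi> sq[OF \<mu>] sq[OF \<nu>]])
  then have int4: "integrable \<pi> (\<lambda>z. - 4 * (norm (fst z))\<^sup>2 * (norm (snd z))\<^sup>2)"
    by (simp add: case_prod_unfold mult.assoc)
  have int2: "integrable \<pi> (\<lambda>z. fst z $ i * snd z $ j)" for i j
    using coupling_product_Cauchy_Schwarz(1)[OF \<pi>
        component_square_integrable(1,2)[OF prob_moment_space_4_2[OF \<mu>], of i]
        component_square_integrable(1,2)[OF prob_moment_space_4_2[OF \<nu>], of j]]
    by (simp add: case_prod_unfold)
  have bil: "x \<bullet> (A *v y) = (\<Sum>i\<in>UNIV. \<Sum>j\<in>UNIV. A $ i $ j * (x $ i * y $ j))" for x y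
    by (simp add: inner_vec_def matrix_vector_mult_def sum_distrib_left mult_ac)
  have intb: "integrable \<pi> (\<lambda>z. \<Sum>i\<in>UNIV. \<Sum>j\<in>UNIV. A $ i $ j * (fst z $ i * snd z $ j))"
    using int2 by simp
  have "(\<integral>z. (\<Sum>i\<in>UNIV. \<Sum>j\<in>UNIV. A $ i $ j * (fst z $ i * snd z $ j)) \<partial>\<pi>) = A \<bullet> cross_moment \<pi>"
    using int2 by (simp add: inner_vec_def cross_moment_def case_prod_unfold)
  then show ?thesis
    unfolding case_prod_unfold cost_def bil
    by (subst Bochner_Integration.integral_diff[OF int4])
      (use intb in simp_all)
qed

lemma cost_complete_square:
  fixes \<mu> :: "(real^'n) measure" and \<nu> :: "(real^'m) measure"
  assumes \<pi>: "\<pi> \<in> couplings \<mu> \<nu>"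
    and \<mu>: "\<mu> \<in> prob_moment_space 4" and \<nu>: "\<nu> \<in> prob_moment_space 4"
  shows "32 * (frobenius_norm A)\<^sup>2 + (\<integral>(x, y). cost A x y \<partial>\<pi>) =
    (\<integral>(x, y). - 4 * (norm x)\<^sup>2 * (norm y)\<^sup>2 \<partial>\<pi>)
      - 8 * (\<Sum>i\<in>UNIV. \<Sum>j\<in>UNIV. (\<integral>(x, y). x $ i * y $ j \<partial>\<pi>)\<^sup>2)
      + 32 * (dist A ((1/2) *\<^sub>R cross_moment \<pi>))\<^sup>2"
proof -
  let ?m = "cross_moment \<pi>"
  have "(\<Sum>i\<in>UNIV. \<Sum>j\<in>UNIV. (\<integral>(x, y). x $ i * y $ j \<partial>\<pi>)\<^sup>2) = ?m \<bullet> ?m"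
    by (simp add: inner_vec_def cross_moment_def power2_eq_square)
  moreover have "(dist A ((1/2) *\<^sub>R ?m))\<^sup>2 = A \<bullet> A - A \<bullet> ?m + (?m \<bullet> ?m) / 4"
    by (simp add: dist_norm power2_norm_eq_inner inner_diff inner_commute[of ?m A] field_simps)
  ultimately show ?thesis
    unfolding integral_cost[OF assms] frobenius_norm_eq_norm power2_norm_eq_inner by simp
qed

section \<open>The variational formula\<close>

theorem theorem1:
  fixes \<epsilon> :: real and \<mu> :: "(real^'n) measure" and \<nu> :: "(real^'m) measure" and M :: real
  assumes "\<epsilon> > 0"
    and "\<mu> \<in> prob_moment_space 4"
    and "\<nu> \<in> prob_moment_space 4"
    and "M = sqrt (moment 2 \<mu> * moment 2 \<nu>)"
  shows "S2 \<epsilon> \<mu> \<nu> = (INF A. ereal (32 * (frobenius_norm A)\<^sup>2) + OT A \<epsilon> \<mu> \<nu>)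
    \<and> (\<exists>A\<in>matrix_box M. ereal (32 * (frobenius_norm A)\<^sup>2) + OT A \<epsilon> \<mu> \<nu>
          = (INF B. ereal (32 * (frobenius_norm B)\<^sup>2) + OT B \<epsilon> \<mu> \<nu>))"
proof -
  define v where "v = (\<lambda>\<pi>. ereal ((\<integral>(x, y). - 4 * (norm x)\<^sup>2 * (norm y)\<^sup>2 \<partial>\<pi>)
      - 8 * (\<Sum>i\<in>UNIV. \<Sum>j\<in>UNIV. (\<integral>(x, y). x $ i * y $ j \<partial>\<pi>)\<^sup>2))
    + ereal \<epsilon> * KL \<pi> (\<mu> \<Otimes>\<^sub>M \<nu>))"
  have "0 \<le> M" using assms(4) by (simp add: moment_def)
  then have "0 \<in> (matrix_box M :: (real^'m^'n) set)" by (simp add: matrix_box_def)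
  then have ne: "(matrix_box M :: (real^'m^'n) set) \<noteq> {}" by blast
  have F: "ereal (32 * (frobenius_norm A)\<^sup>2) + OT A \<epsilon> \<mu> \<nu> =
      (INF \<pi>\<in>couplings \<mu> \<nu>. v \<pi> + ereal (32 * (dist A ((1/2) *\<^sub>R cross_moment \<pi>))\<^sup>2))" for A
    unfolding OT_def INF_ereal_const_add[symmetric]
  proof (rule INF_cong[OF refl])
    fix \<pi> assume "\<pi> \<in> couplings \<mu> \<nu>"
    from cost_complete_square[OF this assms(2,3), of A]
    show "ereal (32 * (frobenius_norm A)\<^sup>2) +
        (ereal (\<integral>(x, y). cost A x y \<partial>\<pi>) + ereal \<epsilon> * KL \<pi> (\<mu> \<Otimes>\<^sub>M \<nu>)) =
        v \<pi> + ereal (32 * (dist A ((1/2) *\<^sub>R cross_moment \<pi>))\<^sup>2)"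
      unfolding v_def add.assoc[symmetric] plus_ereal.simps(1)
      by (simp add: add.assoc add.commute[of "ereal \<epsilon> * _"] flip: plus_ereal.simps(1))
  qed
  have box: "(1/2) *\<^sub>R cross_moment \<pi> \<in> matrix_box M" if "\<pi> \<in> couplings \<mu> \<nu>" for \<pi>
    unfolding assms(4)
    using half_cross_moment_in_box[OF that] assms(2,3) by (simp add: prob_moment_space_4_2)
  have S: "S2 \<epsilon> \<mu> \<nu> = (INF \<pi>\<in>couplings \<mu> \<nu>. v \<pi>)"
    by (simp add: S2_def v_def)
  show ?thesis
    unfolding S F
    using INF_penalty_attained[OF _ compact_matrix_box ne box, where c = 32 and v = v]
    by simp
qed

end
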